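(* Consider the problem of Lagrange $$(L)\qquad\text{minimize } E\sum_{t=0}^TK_t(x_t,\Delta x_t)\ \text{ over }x\in\mathcal N$$ and the dual problem $$(D_L)\qquad\text{maximize } E\Big[-\sum_{t=0}^TK_t^*(p_t+\Delta y_{t+1},y_t)\Big]\ \text{ over }y\in\mathcal Y,\ p\in\mathcal X_a^\perp.$$ If $\operatorname{dom}Ef\cap(\mathcal X\times\mathcal U)\neq\emptyset$ (i.e. $Ef(x,u)<\infty$ for some $(x,u)\in\mathcal X\times\mathcal U$) and $(L)$ and $(D_L)$ are feasible, then the following are equivalent: 1. $x$ solves $(L)$, $(p,y)$ solves $(D_L)$ and there is no duality gap (i.e. $\inf(L)=\sup(D_L)$); 2. $x$ is feasible in $(L)$, $(p,y)$ is feasible in $(D_L)$ and, almost surely for all $t=0,\dots,T$, $$p_t+\Delta y_{t+1}\in\partial_xH_t(x_t,y_t),\qquad \Delta x_t\in\partial_y[-H_t](x_t,y_t).$$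
   Context: $(\Omega,\mathcal F,P)$ is a probability space with a filtration $(\mathcal F_t)_{t=0}^T$ (an increasing sequence of sub-$\sigma$-algebras of $\mathcal F$). Random variables equal a.s. are identified. The expectation of an extended real-valued random variable is $+\infty$ unless its positive part is integrable; the dual objective is read as $-E[\sum_tK_t^*(\cdot)]$. $\mathcal N$ is the space of all processes $x=(x_t)_{t=0}^T$ in $L^0$ with $x_t$ $\mathbb R^d$-valued and $\mathcal F_t$-measurable; $x_{-1}:=0$, $\Delta x_t:=x_t-x_{t-1}$. For $y=(y_t)_{t=0}^T$, $y_{T+1}:=0$ and $\Delta y_{t+1}:=y_{t+1}-y_t$. $K_t$ are convex normal integrands on $\mathbb R^d\times\mathbb R^d\times\Omega$: $K_t(\cdot,\omega)$ is closed convex for every $\omega$ (closed: lower semicontinuous and either proper or constantly $\pm\infty$) and $\omega\mapsto\operatorname{epi}K_t(\cdot,\omega)$ is measurable. $K_t^*$ is the $\omega$-wise conjugate. The Hamiltonian is $H_t(x_t,y_t,\omega):=\inf_{u_t\in\mathbb R^d}\{K_t(x_t,u_t,\omega)-u_t\cdot y_t\}$; $\partial_xH_t$ is the subdifferential of the convex function $H_t(\cdot,y_t,\omega)$ and $\partial_y[-H_t]$ that of the convex function $-H_t(x_t,\cdot,\omega)$ (empty where the function is not finite). $f(x,u,\omega):=\sum_{t=0}^TK_t(x_t,\Delta x_t+u_t,\omega)$ and $Ef(x,u):=\int f(x(\omega),u(\omega),\omega)dP(\omega)$. A linear space of $\mathbb R^k$-valued random variables is decomposable if it contains $1_Au+1_{\Omega\setminus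 A}u'$ for all its elements $u$, all $u'\in L^\infty$, $A\in\mathcal F$; it is solid if it contains every $u\in L^0$ with $|u^i|\le|\bar u^i|$ a.s. for all $i$ for some element $\bar u$. $\mathcal S,\mathcal S'$ are solid decomposable spaces of $\mathbb R^d$-valued random variables in separating duality under $(s,s')\mapsto E[s\cdot s']$; $\mathcal X=\mathcal U=\mathcal S^{T+1}$ and $\mathcal V=\mathcal Y=(\mathcal S')^{T+1}$. $\mathcal X_a:=\mathcal X\cap\mathcal N$, $\mathcal X_a^\perp:=\{v\in\mathcal V: E[x\cdot v]=0\ \forall x\in\mathcal X_a\}$. Feasible in $(L)$: $x\in\mathcal N$ with $E\sum_tK_t(x_t,\Delta x_t)<\infty$. Feasible in $(D_L)$: $(p,y)\in\mathcal X_a^\perp\times\mathcal Y$ with $E\sum_tK_t^*(p_t+\Delta y_{t+1},y_t)<\infty$. A problem is feasible if it has a feasible point; "solves" means feasible and attaining the optimum value. *)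

theory Defs
  imports "HOL-Probability.Probability"
begin

section \<open>Extended real-valued functions\<close>

definition proper_fun :: "('e \<Rightarrow> ereal) \<Rightarrow> bool" where
  "proper_fun h \<longleftrightarrow> (\<forall>z. h z \<noteq> -\<infinity>) \<and> (\<exists>z. h z \<noteq> \<infinity>)"

definition lsc_fun :: "('e::topological_space \<Rightarrow> ereal) \<Rightarrow> bool" where
  "lsc_fun h \<longleftrightarrow> (\<forall>z a. a < h z \<longrightarrow> (\<forall>\<^sub>F w in nhds z. a < h w))"

definition closed_fun :: "('e::topological_space \<Rightarrow> ereal) \<Rightarrow> bool" where
  "closed_fun h \<longleftrightarrow> lsc_fun h \<and> (proper_fun h \<or> h = (\<lambda>_. \<infinity>) \<or> h = (\<lambda>_. -\<infinity>))"

definition epi :: "('e \<Rightarrow> ereal) \<Rightarrow> ('e \<times> real) set" where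
  "epi h = {(z, r). h z \<le> ereal r}"

definition convex_fun :: "('e::real_vector \<Rightarrow> ereal) \<Rightarrow> bool" where
  "convex_fun h \<longleftrightarrow> convex (epi h)"

definition conjugate :: "('e::real_inner \<Rightarrow> ereal) \<Rightarrow> 'e \<Rightarrow> ereal" where
  "conjugate h v = (SUP z. ereal (z \<bullet> v) - h z)"

definition subdifferential :: "('e::real_inner \<Rightarrow> ereal) \<Rightarrow> 'e \<Rightarrow> 'e set" where
  "subdifferential h z =
     {v. \<bar>h z\<bar> \<noteq> \<infinity> \<and> (\<forall>w. h z + ereal (v \<bullet> (w - z)) \<le> h w)}"

text \<open>Measurability of the set-valued map \<open>\<omega> \<mapsto> epi (h \<omega>)\<close> means that preimages
  of open sets are measurable.\<close>

definition convex_normal_integrand :: "'a measure \<Rightarrow> ('a \<Rightarrow> 'e::euclidean_space \<Rightarrow> ereal) \<Rightarrow> bool" where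
  "convex_normal_integrand M h \<longleftrightarrow>
     (\<forall>\<omega>\<in>space M. closed_fun (h \<omega>) \<and> convex_fun (h \<omega>)) \<and>
     (\<forall>U. open U \<longrightarrow> {\<omega>\<in>space M. epi (h \<omega>) \<inter> U \<noteq> {}} \<in> sets M)"

definition hamiltonian :: "('e::real_inner \<times> 'e \<Rightarrow> ereal) \<Rightarrow> 'e \<Rightarrow> 'e \<Rightarrow> ereal" where
  "hamiltonian k x y = (INF u. k (x, u) - ereal (u \<bullet> y))"

section \<open>Expectations and spaces of random variables\<close>

text \<open>The map \<^const>\<open>e2ennreal\<close> sends negative numbers to 0, so the two integrals are those
  of the positive and the negative part. Sums in \<^typ>\<open>ereal\<close> satisfy \<open>\<infinity> + (-\<infinity>) = \<infinity>\<close>, which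
  is the convention matching this expectation.\<close>

definition ext_expectation :: "'a measure \<Rightarrow> ('a \<Rightarrow> ereal) \<Rightarrow> ereal" where
  "ext_expectation M \<phi> =
     (if (\<integral>\<^sup>+\<omega>. e2ennreal (\<phi> \<omega>) \<partial>M) = \<infinity> then \<infinity>
      else enn2ereal (\<integral>\<^sup>+\<omega>. e2ennreal (\<phi> \<omega>) \<partial>M) - enn2ereal (\<integral>\<^sup>+\<omega>. e2ennreal (- \<phi> \<omega>) \<partial>M))"

text \<open>Spaces of equivalence classes of random variables are represented by sets of measurable
  functions; solidity makes such a set closed under almost sure equality.\<close>

definition rv_linear_space :: "'a measure \<Rightarrow> ('a \<Rightarrow> real ^ 'd) set \<Rightarrow> bool" where
  "rv_linear_space M S \<longleftrightarrow>
     S \<subseteq> borel_measurable M \<and> (\<lambda>_. 0) \<in> S \<and>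
     (\<forall>u\<in>S. \<forall>v\<in>S. (\<lambda>\<omega>. u \<omega> + v \<omega>) \<in> S) \<and>
     (\<forall>c. \<forall>u\<in>S. (\<lambda>\<omega>. c *\<^sub>R u \<omega>) \<in> S)"

definition Linfty :: "'a measure \<Rightarrow> ('a \<Rightarrow> real ^ 'd) set" where
  "Linfty M = {u \<in> borel_measurable M. \<exists>C. AE \<omega> in M. norm (u \<omega>) \<le> C}"

definition decomposable :: "'a measure \<Rightarrow> ('a \<Rightarrow> real ^ 'd) set \<Rightarrow> bool" where
  "decomposable M S \<longleftrightarrow>
     (\<forall>u\<in>S. \<forall>u'\<in>Linfty M. \<forall>A\<in>sets M. (\<lambda>\<omega>. if \<omega> \<in> A then u \<omega> else u' \<omega>) \<in> S)"

definition solid :: "'a measure \<Rightarrow> ('a \<Rightarrow> real ^ 'd) set \<Rightarrow> bool" where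
  "solid M S \<longleftrightarrow>
     (\<forall>u\<in>borel_measurable M.
        (\<exists>v\<in>S. AE \<omega> in M. \<forall>i. \<bar>u \<omega> $ i\<bar> \<le> \<bar>v \<omega> $ i\<bar>) \<longrightarrow> u \<in> S)"

definition separating_duality ::
    "'a measure \<Rightarrow> ('a \<Rightarrow> real ^ 'd) set \<Rightarrow> ('a \<Rightarrow> real ^ 'd) set \<Rightarrow> bool" where
  "separating_duality M S S' \<longleftrightarrow>
     (\<forall>s\<in>S. \<forall>s'\<in>S'. integrable M (\<lambda>\<omega>. s \<omega> \<bullet> s' \<omega>)) \<and>
     (\<forall>s\<in>S. (\<forall>s'\<in>S'. (LINT \<omega>|M. s \<omega> \<bullet> s' \<omega>) = 0) \<longrightarrow> (AE \<omega> in M. s \<omega> = 0)) \<and>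
     (\<forall>s'\<in>S'. (\<forall>s\<in>S. (LINT \<omega>|M. s \<omega> \<bullet> s' \<omega>) = 0) \<longrightarrow> (AE \<omega> in M. s' \<omega> = 0))"

section \<open>Processes on the time set 0, ..., T\<close>

text \<open>A process is a function on \<^typ>\<open>nat\<close> of which only the values at times \<open>t \<le> T\<close> matter.\<close>

type_synonym ('a, 'd) process = "nat \<Rightarrow> 'a \<Rightarrow> real ^ 'd"

definition finite_filtration :: "'a measure \<Rightarrow> nat \<Rightarrow> (nat \<Rightarrow> 'a measure) \<Rightarrow> bool" where
  "finite_filtration M T F \<longleftrightarrow>
     (\<forall>t\<le>T. subalgebra M (F t)) \<and> (\<forall>t\<le>T. \<forall>s\<le>t. sets (F s) \<subseteq> sets (F t))"

text \<open>As random variables are identified when equal almost surely, \<open>x t\<close> counts as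
  \<open>F t\<close>-measurable when some version of it is.\<close>

definition adapted :: "'a measure \<Rightarrow> nat \<Rightarrow> (nat \<Rightarrow> 'a measure) \<Rightarrow> ('a, 'd::finite) process set" where
  "adapted M T F =
     {x. \<forall>t\<le>T. x t \<in> borel_measurable M \<and>
        (\<exists>x'\<in>borel_measurable (F t). AE \<omega> in M. x t \<omega> = x' \<omega>)}"

definition processes_in :: "nat \<Rightarrow> ('a \<Rightarrow> real ^ 'd) set \<Rightarrow> ('a, 'd::finite) process set" where
  "processes_in T S = {x. \<forall>t\<le>T. x t \<in> S}"

definition adapted_perp ::
    "'a measure \<Rightarrow> nat \<Rightarrow> (nat \<Rightarrow> 'a measure) \<Rightarrow> ('a \<Rightarrow> real ^ 'd) set \<Rightarrow> ('a \<Rightarrow> real ^ 'd) set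
      \<Rightarrow> ('a, 'd::finite) process set" where
  "adapted_perp M T F S S' =
     {v \<in> processes_in T S'. \<forall>x \<in> processes_in T S \<inter> adapted M T F.
        (LINT \<omega>|M. (\<Sum>t\<le>T. x t \<omega> \<bullet> v t \<omega>)) = 0}"

text \<open>\<open>bdiff x t\<close> is \<open>x\<^sub>t - x\<^sub>t\<^sub>-\<^sub>1\<close> with value 0 at time \<open>-1\<close>, and \<open>fdiff T y t\<close> is
  \<open>y\<^sub>t\<^sub>+\<^sub>1 - y\<^sub>t\<close> with value 0 at time \<open>T + 1\<close>.\<close>

definition bdiff :: "('a, 'd::finite) process \<Rightarrow> ('a, 'd) process" where
  "bdiff x t \<omega> = x t \<omega> - (if t = 0 then 0 else x (t - 1) \<omega>)"

definition fdiff :: "nat \<Rightarrow> ('a, 'd::finite) process \<Rightarrow> ('a, 'd) process" where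
  "fdiff T y t \<omega> = (if t = T then 0 else y (t + 1) \<omega>) - y t \<omega>"

section \<open>The problem of Lagrange and its dual\<close>

type_synonym ('a, 'd) lagrangian = "nat \<Rightarrow> 'a \<Rightarrow> (real ^ 'd) \<times> (real ^ 'd) \<Rightarrow> ereal"

definition Ef ::
    "'a measure \<Rightarrow> nat \<Rightarrow> ('a, 'd::finite) lagrangian \<Rightarrow> ('a, 'd) process \<Rightarrow> ('a, 'd) process \<Rightarrow> ereal" where
  "Ef M T K x u = ext_expectation M (\<lambda>\<omega>. \<Sum>t\<le>T. K t \<omega> (x t \<omega>, bdiff x t \<omega> + u t \<omega>))"

definition primal_obj ::
    "'a measure \<Rightarrow> nat \<Rightarrow> ('a, 'd::finite) lagrangian \<Rightarrow> ('a, 'd) process \<Rightarrow> ereal" where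
  "primal_obj M T K x = ext_expectation M (\<lambda>\<omega>. \<Sum>t\<le>T. K t \<omega> (x t \<omega>, bdiff x t \<omega>))"

definition primal_feasible ::
    "'a measure \<Rightarrow> nat \<Rightarrow> (nat \<Rightarrow> 'a measure) \<Rightarrow> ('a, 'd::finite) lagrangian
      \<Rightarrow> ('a, 'd) process \<Rightarrow> bool" where
  "primal_feasible M T F K x \<longleftrightarrow> x \<in> adapted M T F \<and> primal_obj M T K x < \<infinity>"

definition primal_value ::
    "'a measure \<Rightarrow> nat \<Rightarrow> (nat \<Rightarrow> 'a measure) \<Rightarrow> ('a, 'd::finite) lagrangian \<Rightarrow> ereal" where
  "primal_value M T F K = (INF x\<in>adapted M T F. primal_obj M T K x)"

definition primal_solves ::
    "'a measure \<Rightarrow> nat \<Rightarrow> (nat \<Rightarrow> 'a measure) \<Rightarrow> ('a, 'd::finite) lagrangian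
      \<Rightarrow> ('a, 'd) process \<Rightarrow> bool" where
  "primal_solves M T F K x \<longleftrightarrow>
     primal_feasible M T F K x \<and> primal_obj M T K x = primal_value M T F K"

definition dual_cost ::
    "'a measure \<Rightarrow> nat \<Rightarrow> ('a, 'd::finite) lagrangian \<Rightarrow> ('a, 'd) process \<times> ('a, 'd) process \<Rightarrow> ereal" where
  "dual_cost M T K = (\<lambda>(p, y). ext_expectation M
     (\<lambda>\<omega>. \<Sum>t\<le>T. conjugate (K t \<omega>) (p t \<omega> + fdiff T y t \<omega>, y t \<omega>)))"

definition dual_domain ::
    "'a measure \<Rightarrow> nat \<Rightarrow> (nat \<Rightarrow> 'a measure) \<Rightarrow> ('a \<Rightarrow> real ^ 'd) set \<Rightarrow> ('a \<Rightarrow> real ^ 'd) set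
      \<Rightarrow> (('a, 'd::finite) process \<times> ('a, 'd) process) set" where
  "dual_domain M T F S S' = adapted_perp M T F S S' \<times> processes_in T S'"

definition dual_feasible ::
    "'a measure \<Rightarrow> nat \<Rightarrow> (nat \<Rightarrow> 'a measure) \<Rightarrow> ('a \<Rightarrow> real ^ 'd) set \<Rightarrow> ('a \<Rightarrow> real ^ 'd) set
      \<Rightarrow> ('a, 'd::finite) lagrangian \<Rightarrow> ('a, 'd) process \<times> ('a, 'd) process \<Rightarrow> bool" where
  "dual_feasible M T F S S' K py \<longleftrightarrow> py \<in> dual_domain M T F S S' \<and> dual_cost M T K py < \<infinity>"

definition dual_value ::
    "'a measure \<Rightarrow> nat \<Rightarrow> (nat \<Rightarrow> 'a measure) \<Rightarrow> ('a \<Rightarrow> real ^ 'd) set \<Rightarrow> ('a \<Rightarrow> real ^ 'd) set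
      \<Rightarrow> ('a, 'd::finite) lagrangian \<Rightarrow> ereal" where
  "dual_value M T F S S' K = (SUP py\<in>dual_domain M T F S S'. - dual_cost M T K py)"

definition dual_solves ::
    "'a measure \<Rightarrow> nat \<Rightarrow> (nat \<Rightarrow> 'a measure) \<Rightarrow> ('a \<Rightarrow> real ^ 'd) set \<Rightarrow> ('a \<Rightarrow> real ^ 'd) set
      \<Rightarrow> ('a, 'd::finite) lagrangian \<Rightarrow> ('a, 'd) process \<times> ('a, 'd) process \<Rightarrow> bool" where
  "dual_solves M T F S S' K py \<longleftrightarrow>
     dual_feasible M T F S S' K py \<and> - dual_cost M T K py = dual_value M T F S S' K"

end

(*
  Weak duality with a pointwise gap: summation by parts turns the sum of the Fenchel inequalities
  K_t(x_t, dx_t) + K_t^*(p_t + dy_{t+1}, y_t) >= x_t . (p_t + dy_{t+1}) + dx_t . y_t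
  into a lower bound sum_t x_t . p_t, whose expectation vanishes: p is orthogonal to the
  bounded adapted processes, and, as for local martingales, this extends to every adapted x
  for which the sum has an integrable upper bound. Hence the duality gap of a feasible pair is
  the expectation of a nonnegative random variable, which vanishes almost surely iff Fenchel's
  inequality is an equality for all t. By biconjugation in the second argument of K_t alone, the
  equality is equivalent to the Hamiltonian conditions.
*)
theory Submission
  imports Defs
begin

text \<open>The obstacle is integrability. A feasible \<open>x\<close> is merely adapted, without
  any moment condition, so the terms x_t . p_t need not be integrable and orthogonality says nothing
  about them directly. What feasibility provides is one-sided: an expectation below \<infinity> has
  an integrable positive part, so both cost integrands have integrable majorants, and Fenchel's
  inequality turns these into an upper bound for sum_t x_t . p_t. Once that sum is known to be
  integrable, it in turn bounds each cost integrand from below, so that both objectives are finite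
  and no \<infinity> - \<infinity> can occur. On the convex side, H_t(x, .) is minus the conjugate
  of the section K_t(x, .), and having a subgradient includes finiteness of H_t(x_t, y_t). This
  finite value supplies an affine minorant of the section with slope y_t, so biconjugation needs no
  properness of the section, which could a priori be \<infinity> everywhere.\<close>

section \<open>Measurability of normal integrands and of their conjugates\<close>

lemma mem_epi [simp]: "(z, r) \<in> epi h \<longleftrightarrow> h z \<le> ereal r"
  by (simp add: epi_def)

lemma closed_epi:
  assumes "lsc_fun h"
  shows "closed (epi h)"
proof -
  have "\<exists>A B. open A \<and> open B \<and> q \<in> A \<times> B \<and> A \<times> B \<subseteq> - epi h" if "q \<in> - epi h" for q
  proof -
    obtain z r where q: "q = (z, r)"
      by (cases q)
    have "ereal r < h z"
      using that q by simp
    then obtain a where a: "ereal r < ereal a" "ereal a < h z"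
      using ereal_dense2 by blast
    have "\<forall>\<^sub>F w in nhds z. ereal a < h w"
      using assms a(2) by (auto simp: lsc_fun_def)
    then obtain U where U: "open U" "z \<in> U" "\<And>w. w \<in> U \<Longrightarrow> ereal a < h w"
      by (auto simp: eventually_nhds)
    have "U \<times> {..<a} \<subseteq> - epi h"
    proof
      fix s assume "s \<in> U \<times> {..<a}"
      then obtain w b where s: "s = (w, b)" "w \<in> U" "b < a"
        by auto
      have "ereal b < h w"
        using U(3)[OF s(2)] s(3) less_trans[of "ereal b" "ereal a"] by simp
      then show "s \<in> - epi h"
        using s(1) by simp
    qed
    then show ?thesis
      using U a(1) q by (intro exI[of _ U] exI[of _ "{..<a}"]) auto
  qed
  then show ?thesis
    unfolding closed_def open_prod_def by blast
qed

lemma convex_normal_integrandD: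
  assumes "convex_normal_integrand M h"
  shows "\<And>\<omega>. \<omega> \<in> space M \<Longrightarrow> closed_fun (h \<omega>)"
    and "\<And>\<omega>. \<omega> \<in> space M \<Longrightarrow> convex_fun (h \<omega>)"
    and "\<And>U. open U \<Longrightarrow> {\<omega>\<in>space M. epi (h \<omega>) \<inter> U \<noteq> {}} \<in> sets M"
  using assms by (auto simp: convex_normal_integrand_def)

text \<open>The epigraph is closed, so a point lies outside it iff some basic open set around the
  point misses it. Only countably many basic sets are involved, and for each of them the hypothesis
  on preimages of open sets applies.\<close>

lemma borel_measurable_normal_integrand:
  fixes h :: "'a \<Rightarrow> 'e::euclidean_space \<Rightarrow> ereal"
  assumes h: "convex_normal_integrand M h" and z: "z \<in> borel_measurable M"
  shows "(\<lambda>\<omega>. h \<omega> (z \<omega>)) \<in> borel_measurable M"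
proof (rule borel_measurableI_greater)
  fix a :: ereal
  obtain \<B> :: "('e \<times> real) set set" where \<B>: "countable \<B>" "topological_basis \<B>"
    using ex_countable_basis by blast
  have less_iff: "ereal r < h \<omega> (z \<omega>) \<longleftrightarrow> (\<exists>B\<in>\<B>. (z \<omega>, r) \<in> B \<and> epi (h \<omega>) \<inter> B = {})"
    if "\<omega> \<in> space M" for r \<omega>
  proof
    assume "ereal r < h \<omega> (z \<omega>)"
    then have "(z \<omega>, r) \<in> - epi (h \<omega>)"
      by simp
    moreover have "open (- epi (h \<omega>))"
      using closed_epi convex_normal_integrandD(1)[OF h that] by (auto simp: closed_fun_def)
    ultimately obtain B where "B \<in> \<B>" "(z \<omega>, r) \<in> B" "B \<subseteq> - epi (h \<omega>)"
      using \<B>(2) topological_basisE by blast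
    then show "\<exists>B\<in>\<B>. (z \<omega>, r) \<in> B \<and> epi (h \<omega>) \<inter> B = {}"
      by blast
  next
    assume "\<exists>B\<in>\<B>. (z \<omega>, r) \<in> B \<and> epi (h \<omega>) \<inter> B = {}"
    then have "(z \<omega>, r) \<notin> epi (h \<omega>)"
      by blast
    then show "ereal r < h \<omega> (z \<omega>)"
      by simp
  qed
  have real_meas: "{\<omega>\<in>space M. ereal r < h \<omega> (z \<omega>)} \<in> sets M" for r
  proof -
    have eq: "{\<omega>\<in>space M. ereal r < h \<omega> (z \<omega>)} =
      (\<Union>B\<in>\<B>. {\<omega>\<in>space M. (z \<omega>, r) \<in> B} - {\<omega>\<in>space M. epi (h \<omega>) \<inter> B \<noteq> {}})"
      using less_iff by blast
    have "{\<omega>\<in>space M. (z \<omega>, r) \<in> B} - {\<omega>\<in>space M. epi (h \<omega>) \<inter> B \<noteq> {}} \<in> sets M"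
      if "B \<in> \<B>" for B
    proof (intro sets.Diff)
      have B: "open B"
        using \<B>(2) that by (rule topological_basis_open)
      show "{\<omega>\<in>space M. epi (h \<omega>) \<inter> B \<noteq> {}} \<in> sets M"
        using convex_normal_integrandD(3)[OF h B] .
      have "(\<lambda>\<omega>. (z \<omega>, r)) \<in> borel_measurable M"
        using z by simp
      then have "(\<lambda>\<omega>. (z \<omega>, r)) -` B \<inter> space M \<in> sets M"
        using B by (intro measurable_sets) auto
      also have "(\<lambda>\<omega>. (z \<omega>, r)) -` B \<inter> space M = {\<omega>\<in>space M. (z \<omega>, r) \<in> B}"
        by auto
      finally show "{\<omega>\<in>space M. (z \<omega>, r) \<in> B} \<in> sets M" .
    qed
    then show ?thesis
      unfolding eq using \<B>(1) by (intro sets.countable_UN') auto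
  qed
  show "{\<omega>\<in>space M. a < h \<omega> (z \<omega>)} \<in> sets M"
  proof (cases a)
    case (real r)
    then show ?thesis using real_meas by simp
  next
    case MInf
    have "{\<omega>\<in>space M. a < h \<omega> (z \<omega>)} = (\<Union>n::nat. {\<omega>\<in>space M. ereal (- real n) < h \<omega> (z \<omega>)})"
    proof (intro equalityI subsetI)
      fix \<omega> assume "\<omega> \<in> {\<omega>\<in>space M. a < h \<omega> (z \<omega>)}"
      then have \<omega>: "\<omega> \<in> space M" "h \<omega> (z \<omega>) \<noteq> -\<infinity>"
        using MInf by auto
      have "\<exists>n::nat. ereal (- real n) < h \<omega> (z \<omega>)"
      proof (cases "h \<omega> (z \<omega>)")
        case (real r)
        obtain n :: nat where "- r < real n"
          using reals_Archimedean2 by blast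
        then show ?thesis
          using real by (intro exI[of _ n]) simp
      qed (use \<omega> in auto)
      then show "\<omega> \<in> (\<Union>n::nat. {\<omega>\<in>space M. ereal (- real n) < h \<omega> (z \<omega>)})"
        using \<omega> by auto
    next
      fix \<omega> assume "\<omega> \<in> (\<Union>n::nat. {\<omega>\<in>space M. ereal (- real n) < h \<omega> (z \<omega>)})"
      then show "\<omega> \<in> {\<omega>\<in>space M. a < h \<omega> (z \<omega>)}"
        using MInf by auto
    qed
    then show ?thesis
      using real_meas by auto
  qed simp
qed

text \<open>Taking the supremum over the epigraph replaces the extended-real difference by a
  continuous real function and brings the conjugate into the form that the measurability of
  \<open>epi\<close> speaks about.\<close>

lemma less_conjugate_iff:
  "a < conjugate h v \<longleftrightarrow> (\<exists>(z, r)\<in>epi h. a < ereal (z \<bullet> v - r))"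
proof -
  have "a < ereal (z \<bullet> v) - h z \<longleftrightarrow> (\<exists>r. h z \<le> ereal r \<and> a < ereal (z \<bullet> v - r))" for z
  proof (cases "h z")
    case (real s)
    have "a < ereal (z \<bullet> v - s)" if "s \<le> r" "a < ereal (z \<bullet> v - r)" for r
      using that(2) by (rule less_le_trans) (use that(1) in simp)
    then show ?thesis
      using real by auto
  next
    case PInf
    then show ?thesis by simp
  next
    case MInf
    have "\<exists>r. a < ereal (z \<bullet> v - r)" if "a < \<infinity>"
    proof -
      \<comment> \<open>Above a point with value -\<infinity> every height is allowed, and the
        height \<open>z \<bullet> v - b\<close> makes the affine expression equal to
        \<open>b\<close>.\<close>
      obtain b where "a < ereal b"
        using \<open>a < \<infinity>\<close> ereal_dense2 by blast
      then show ?thesis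
        by (intro exI[of _ "z \<bullet> v - b"]) simp
    qed
    then show ?thesis
      using MInf by (auto simp: less_top[symmetric] top_ereal_def)
  qed
  then show ?thesis
    by (force simp: conjugate_def less_SUP_iff epi_def)
qed

text \<open>The inequality \<open>a < z \<bullet> w - r\<close> is an open condition on
  \<open>((z, r), w)\<close>, hence a countable union of products of basic open sets. On each
  product the conditions on the epigraph and on \<open>v\<close> separate, and each is
  measurable.\<close>

lemma borel_measurable_conjugate_normal_integrand:
  fixes h :: "'a \<Rightarrow> 'e::euclidean_space \<Rightarrow> ereal"
  assumes h: "convex_normal_integrand M h" and v: "v \<in> borel_measurable M"
  shows "(\<lambda>\<omega>. conjugate (h \<omega>) (v \<omega>)) \<in> borel_measurable M"
proof (rule borel_measurableI_greater)
  fix a :: ereal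
  obtain \<B> :: "('e \<times> real) set set" where \<B>: "countable \<B>" "topological_basis \<B>"
    using ex_countable_basis by blast
  obtain \<C> :: "'e set set" where \<C>: "countable \<C>" "topological_basis \<C>"
    using ex_countable_basis by blast
  define W where "W = {((z, r), w :: 'e). a < ereal (z \<bullet> w - r)}"
  have W: "open W"
  proof -
    have "W = (\<lambda>q. ereal (fst (fst q) \<bullet> snd q - snd (fst q))) -` {a<..}"
      by (auto simp: W_def)
    then show ?thesis
      by (auto intro!: open_vimage continuous_intros)
  qed
  define I where "I = {(B, C) \<in> \<B> \<times> \<C>. B \<times> C \<subseteq> W}"
  have "countable I"
    using \<B>(1) \<C>(1) by (auto simp: I_def intro: countable_subset[of _ "\<B> \<times> \<C>"])
  have eq: "{\<omega>\<in>space M. a < conjugate (h \<omega>) (v \<omega>)} =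
    (\<Union>(B, C)\<in>I. {\<omega>\<in>space M. epi (h \<omega>) \<inter> B \<noteq> {}} \<inter> {\<omega>\<in>space M. v \<omega> \<in> C})"
  proof (intro equalityI subsetI)
    fix \<omega> assume "\<omega> \<in> {\<omega>\<in>space M. a < conjugate (h \<omega>) (v \<omega>)}"
    then obtain z r where zr: "\<omega> \<in> space M" "(z, r) \<in> epi (h \<omega>)" "((z, r), v \<omega>) \<in> W"
      by (auto simp: less_conjugate_iff W_def)
    then obtain A' C' where "open A'" "open C'" "(z, r) \<in> A'" "v \<omega> \<in> C'" "A' \<times> C' \<subseteq> W"
      using W unfolding open_prod_def by (metis mem_Sigma_iff)
    moreover obtain B where "B \<in> \<B>" "(z, r) \<in> B" "B \<subseteq> A'"
      using \<B>(2) topological_basisE calculation by blast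
    moreover obtain C where "C \<in> \<C>" "v \<omega> \<in> C" "C \<subseteq> C'"
      using \<C>(2) topological_basisE calculation by blast
    ultimately have "(B, C) \<in> I" "(z, r) \<in> epi (h \<omega>) \<inter> B" "v \<omega> \<in> C"
      using zr(2) by (auto simp: I_def)
    then show "\<omega> \<in> (\<Union>(B, C)\<in>I. {\<omega>\<in>space M. epi (h \<omega>) \<inter> B \<noteq> {}} \<inter> {\<omega>\<in>space M. v \<omega> \<in> C})"
      using zr(1) by blast
  next
    fix \<omega> assume "\<omega> \<in> (\<Union>(B, C)\<in>I. {\<omega>\<in>space M. epi (h \<omega>) \<inter> B \<noteq> {}} \<inter> {\<omega>\<in>space M. v \<omega> \<in> C})"
    then obtain B C where BC: "(B, C) \<in> I" "epi (h \<omega>) \<inter> B \<noteq> {}" "v \<omega> \<in> C" "\<omega> \<in> space M"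
      by auto
    then obtain z r where "(z, r) \<in> epi (h \<omega>)" "(z, r) \<in> B"
      by auto
    moreover have "B \<times> C \<subseteq> W"
      using BC(1) by (simp add: I_def)
    ultimately have "((z, r), v \<omega>) \<in> W"
      using BC(3) by blast
    then have "a < conjugate (h \<omega>) (v \<omega>)"
      unfolding less_conjugate_iff using \<open>(z, r) \<in> epi (h \<omega>)\<close> W_def by blast
    then show "\<omega> \<in> {\<omega>\<in>space M. a < conjugate (h \<omega>) (v \<omega>)}"
      using BC(4) by simp
  qed
  have "{\<omega>\<in>space M. epi (h \<omega>) \<inter> B \<noteq> {}} \<inter> {\<omega>\<in>space M. v \<omega> \<in> C} \<in> sets M" if "(B, C) \<in> I" for B C
  proof (rule sets.Int)
    have "open B" "open C"
      using that \<B>(2) \<C>(2) by (auto simp: I_def intro: topological_basis_open)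
    then show "{\<omega>\<in>space M. epi (h \<omega>) \<inter> B \<noteq> {}} \<in> sets M"
      using convex_normal_integrandD(3)[OF h] by blast
    have "v -` C \<inter> space M \<in> sets M"
      using \<open>open C\<close> v by (intro measurable_sets) auto
    also have "v -` C \<inter> space M = {\<omega>\<in>space M. v \<omega> \<in> C}"
      by auto
    finally show "{\<omega>\<in>space M. v \<omega> \<in> C} \<in> sets M" .
  qed
  then show "{\<omega>\<in>space M. a < conjugate (h \<omega>) (v \<omega>)} \<in> sets M"
    unfolding eq using \<open>countable I\<close> by (intro sets.countable_UN') auto
qed

section \<open>Pointwise convex analysis: Fenchel equality and the Hamiltonian\<close>

text \<open>Each finiteness assumption rules out -\<infinity> for the other function: a value
  -\<infinity> of \<open>h\<close> would make the conjugate \<infinity>, and a finite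
  \<open>h z\<close> bounds the conjugate from below.\<close>

lemma fenchel_young:
  assumes "h z < \<infinity>" "conjugate h v < \<infinity>"
  obtains a b where "h z = ereal a" "conjugate h v = ereal b" "z \<bullet> v \<le> a + b"
proof -
  have le: "ereal (w \<bullet> v) - h w \<le> conjugate h v" for w
    unfolding conjugate_def by (rule SUP_upper) simp
  have "h w \<noteq> -\<infinity>" for w
    using le[of w] assms(2) by auto
  then obtain a where a: "h z = ereal a"
    using assms(1) by (cases "h z") auto
  moreover obtain b where b: "conjugate h v = ereal b"
    using assms(2) le[of z] a by (cases "conjugate h v") auto
  moreover have "z \<bullet> v \<le> a + b"
    using le[of z] a b by simp
  ultimately show thesis
    by (rule that)
qed

text \<open>The nontrivial half of the Fenchel-Moreau theorem at a single point: were
  \<open>(u, m)\<close> strictly below the graph, it could be separated from the closed convex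
  epigraph. The minorant in \<open>bound\<close> stands in for properness; it excludes the value
  -\<infinity>, while \<open>g\<close> may still be \<infinity> everywhere.\<close>

lemma biconjugate_point:
  fixes g :: "'e::euclidean_space \<Rightarrow> ereal"
  assumes lsc: "lsc_fun g" and conv: "convex_fun g"
    and bound: "\<And>w. ereal (w \<bullet> y + c) \<le> g w"
    and le: "\<And>y' c'. (\<And>w. ereal (w \<bullet> y' + c') \<le> g w) \<Longrightarrow> u \<bullet> y' + c' \<le> m"
  shows "g u \<le> ereal m"
proof (rule ccontr)
  assume "\<not> g u \<le> ereal m"
  then have "(u, m) \<notin> epi g"
    by simp
  then obtain ab d where sep: "ab \<bullet> (u, m) < d" "\<And>q. q \<in> epi g \<Longrightarrow> ab \<bullet> q > d"
    using separating_hyperplane_closed_point[of "epi g" "(u, m)"] closed_epi[OF lsc] conv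
    unfolding convex_fun_def by blast
  obtain a b where ab: "ab = (a, b)"
    by (cases ab)
  have sep1: "a \<bullet> u + b * m < d"
    using sep(1) ab by simp
  have sep2: "d < a \<bullet> w + b * r" if "g w \<le> ereal r" for w r
    using sep(2)[of "(w, r)"] that ab by simp
  consider "b > 0" | "b = 0" | "b < 0" by linarith
  then show False
  proof cases
    case 1
    \<comment> \<open>The hyperplane is the graph of an affine minorant here, and
      \<open>sep1\<close> says that its value at \<open>u\<close> exceeds \<open>m\<close>.\<close>
    have "ereal (w \<bullet> (- (1 / b) *\<^sub>R a) + d / b) \<le> g w" for w
    proof (cases "g w")
      case (real r)
      then have "d < a \<bullet> w + b * r"
        by (intro sep2) simp
      then have "d / b - (a \<bullet> w) / b \<le> r"
        using 1 by (simp add: field_simps)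
      then show ?thesis
        using real by (simp add: inner_commute algebra_simps)
    next
      case MInf
      then show ?thesis using bound[of w] by simp
    qed simp
    from le[OF this] have "d / b - (a \<bullet> u) / b \<le> m"
      by (simp add: inner_commute algebra_simps)
    then have "d - a \<bullet> u \<le> b * m"
      using 1 by (simp add: field_simps)
    then show False
      using sep1 by simp
  next
    case 2
    \<comment> \<open>A vertical hyperplane: tilt the affine minorant by multiples of it.\<close>
    have tilted: "u \<bullet> (y - n *\<^sub>R a) + (c + n * d) \<le> m" if "n \<ge> 0" for n :: real
    proof (rule le)
      fix w
      show "ereal (w \<bullet> (y - n *\<^sub>R a) + (c + n * d)) \<le> g w"
      proof (cases "g w")
        case (real r)
        then have "d < a \<bullet> w"
          using sep2[of w r] 2 by simp
        then have "n * d \<le> n * (a \<bullet> w)"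
          using that by (intro mult_left_mono) auto
        moreover have "w \<bullet> y + c \<le> r"
          using bound[of w] real by simp
        ultimately show ?thesis
          using real by (simp add: inner_diff_right inner_commute)
      next
        case MInf
        then show ?thesis using bound[of w] by simp
      qed simp
    qed
    have le_n: "n * (d - a \<bullet> u) \<le> m - u \<bullet> y - c" if "n \<ge> 0" for n :: real
      using tilted[OF that] by (simp add: inner_diff_right right_diff_distrib inner_commute)
    have "0 < d - a \<bullet> u"
      using sep1 2 by simp
    \<comment> \<open>Chosen so that the left side of \<open>le_n\<close> exceeds its right side;
      the absolute value keeps \<open>n\<close> nonnegative.\<close>
    define n where "n = (\<bar>m - u \<bullet> y - c\<bar> + 1) / (d - a \<bullet> u)"
    have "n \<ge> 0" "n * (d - a \<bullet> u) = \<bar>m - u \<bullet> y - c\<bar> + 1"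
      using \<open>0 < d - a \<bullet> u\<close> by (auto simp: n_def)
    with le_n[of n] show False
      by linarith
  next
    case 3
    show False
    proof (cases "\<exists>w. g w < \<infinity>")
      case True
      then obtain w where "g w < \<infinity>" by blast
      then obtain r where r: "g w = ereal r"
        using bound[of w] by (cases "g w") auto
      \<comment> \<open>The second entry is the height at which the hyperplane passes over
        \<open>w\<close>. As the epigraph extends upwards without end, it contains a point on the
        wrong side when \<open>b < 0\<close>.\<close>
      define s where "s = max r ((d - a \<bullet> w) / b)"
      have "d < a \<bullet> w + b * s"
        using r by (intro sep2) (simp add: s_def)
      moreover have "b * s \<le> b * ((d - a \<bullet> w) / b)"
        using 3 by (intro mult_left_mono_neg) (auto simp: s_def)
      ultimately show False
        using 3 by simp
    next
      case False
      \<comment> \<open>With an empty epigraph every affine function is a minorant, and the constant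
        \<open>m + 1\<close> already contradicts \<open>le\<close>.\<close>
      then have "ereal (w \<bullet> 0 + (m + 1)) \<le> g w" for w
        by simp
      from le[OF this] show False
        by simp
    qed
  qed
qed

text \<open>The condition on \<open>u\<close> is Fenchel equality for the section of
  \<open>k\<close> at \<open>x\<close>, whose conjugate is minus the Hamiltonian. The condition on
  \<open>v\<close> then extends it to joint equality, since the Hamiltonian is already the infimum
  over the second argument.\<close>

lemma subgradients_hamiltonian_iff:
  fixes k :: "'e::euclidean_space \<times> 'e \<Rightarrow> ereal"
  assumes "closed_fun k" "convex_fun k"
  shows "v \<in> subdifferential (\<lambda>x'. hamiltonian k x' y) x \<and>
      u \<in> subdifferential (\<lambda>y'. - hamiltonian k x y') y \<longleftrightarrow>
    (\<exists>a b. k (x, u) = ereal a \<and> conjugate k (v, y) = ereal b \<and> a + b = x \<bullet> v + u \<bullet> y)"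
    (is "?L \<longleftrightarrow> ?R")
proof
  assume ?R
  then obtain a b where ab: "k (x, u) = ereal a" "conjugate k (v, y) = ereal b" "a + b = x \<bullet> v + u \<bullet> y"
    by blast
  have lower: "ereal (x' \<bullet> v - b) \<le> hamiltonian k x' y" for x'
    unfolding hamiltonian_def
  proof (rule INF_greatest)
    fix u'
    have "ereal ((x', u') \<bullet> (v, y)) - k (x', u') \<le> ereal b"
      unfolding ab(2)[symmetric] conjugate_def by (rule SUP_upper) simp
    then show "ereal (x' \<bullet> v - b) \<le> k (x', u') - ereal (u' \<bullet> y)"
      by (cases "k (x', u')") auto
  qed
  have upper: "hamiltonian k x y' \<le> ereal (a - u \<bullet> y')" for y'
  proof -
    have "hamiltonian k x y' \<le> k (x, u) - ereal (u \<bullet> y')"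
      unfolding hamiltonian_def by (rule INF_lower) simp
    then show ?thesis
      using ab(1) by simp
  qed
  \<comment> \<open>Fenchel equality makes the lower bound at \<open>x\<close> and the upper bound
    at \<open>y\<close> coincide, so the Hamiltonian is finite and both bounds become subgradient
    inequalities.\<close>
  have "a - u \<bullet> y = x \<bullet> v - b"
    using ab(3) by simp
  then have H: "hamiltonian k x y = ereal (x \<bullet> v - b)"
    using lower[of x] upper[of y] by (intro antisym) auto
  show ?L
  proof
    show "v \<in> subdifferential (\<lambda>x'. hamiltonian k x' y) x"
      using lower by (auto simp: subdifferential_def H inner_diff_right inner_commute)
    have "ereal (- (x \<bullet> v - b) + u \<bullet> (w - y)) \<le> - hamiltonian k x w" for w
    proof -
      have "ereal (- (a - u \<bullet> w)) \<le> - hamiltonian k x w"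
        using upper[of w] by (metis ereal_minus_le_minus uminus_ereal.simps(1))
      moreover have "- (x \<bullet> v - b) + u \<bullet> (w - y) = - (a - u \<bullet> w)"
        using ab(3) by (simp add: inner_diff_right)
      ultimately show ?thesis
        by simp
    qed
    then show "u \<in> subdifferential (\<lambda>y'. - hamiltonian k x y') y"
      by (auto simp: subdifferential_def H)
  qed
next
  assume L: ?L
  then have "\<bar>hamiltonian k x y\<bar> \<noteq> \<infinity>"
    by (simp add: subdifferential_def)
  then obtain e where e: "hamiltonian k x y = ereal e"
    by auto
  have sub_x: "ereal (e + v \<bullet> (w - x)) \<le> hamiltonian k w y" for w
    using L e by (auto simp: subdifferential_def)
  have sub_y: "ereal (- e + u \<bullet> (w - y)) \<le> - hamiltonian k x w" for w
    using L e by (auto simp: subdifferential_def)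
  have ham_le: "hamiltonian k x' y' \<le> k (x', u') - ereal (u' \<bullet> y')" for x' y' u'
    unfolding hamiltonian_def by (rule INF_lower) simp
  have lsc: "lsc_fun (\<lambda>w. k (x, w))"
    unfolding lsc_fun_def
  proof (intro allI impI)
    fix w a assume "a < k (x, w)"
    then have ev: "\<forall>\<^sub>F q in nhds (x, w). a < k q"
      using assms(1) by (auto simp: closed_fun_def lsc_fun_def)
    have "filterlim (\<lambda>w'. (x, w')) (nhds (x, w)) (nhds w)"
      by (intro tendsto_intros filterlim_ident)
    with ev show "\<forall>\<^sub>F w' in nhds w. a < k (x, w')"
      by (rule eventually_compose_filterlim)
  qed
  have conv: "convex_fun (\<lambda>w. k (x, w))"
    unfolding convex_fun_def
  proof (rule convexI)
    fix q q' :: "'e \<times> real" and \<alpha> \<beta> :: real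
    assume q: "q \<in> epi (\<lambda>w. k (x, w))" "q' \<in> epi (\<lambda>w. k (x, w))" and \<alpha>: "0 \<le> \<alpha>" "0 \<le> \<beta>" "\<alpha> + \<beta> = 1"
    obtain w r w' r' where eq: "q = (w, r)" "q' = (w', r')"
      by (cases q, cases q')
    have "((x, w), r) \<in> epi k" "((x, w'), r') \<in> epi k"
      using q eq by simp_all
    then have "\<alpha> *\<^sub>R ((x, w), r) + \<beta> *\<^sub>R ((x, w'), r') \<in> epi k"
      using assms(2) \<alpha> unfolding convex_fun_def by (intro convexD) auto
    then show "\<alpha> *\<^sub>R q + \<beta> *\<^sub>R q' \<in> epi (\<lambda>w. k (x, w))"
      using \<alpha>(3) eq by (simp flip: scaleR_add_left)
  qed
  \<comment> \<open>The section has an affine minorant of slope \<open>y'\<close> and constant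
    \<open>c'\<close> iff \<open>c'\<close> is at most the Hamiltonian at \<open>(x, y')\<close>.
    Bounding all minorants at \<open>u\<close> is therefore the subgradient inequality
    \<open>sub_y\<close>.\<close>
  have "k (x, u) \<le> ereal (u \<bullet> y + e)"
  proof (rule biconjugate_point[OF lsc conv])
    fix w show "ereal (w \<bullet> y + e) \<le> k (x, w)"
      using ham_le[of x y w] e by (cases "k (x, w)") auto
  next
    fix y' c' assume minor: "\<And>w. ereal (w \<bullet> y' + c') \<le> k (x, w)"
    have "ereal c' \<le> hamiltonian k x y'"
      unfolding hamiltonian_def
    proof (rule INF_greatest)
      fix w show "ereal c' \<le> k (x, w) - ereal (w \<bullet> y')"
        using minor[of w] by (cases "k (x, w)") auto
    qed
    then have "- hamiltonian k x y' \<le> ereal (- c')"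
      by (metis ereal_minus_le_minus uminus_ereal.simps(1))
    with sub_y[of y'] have "ereal (- e + u \<bullet> (y' - y)) \<le> ereal (- c')"
      by (rule order_trans)
    then show "u \<bullet> y' + c' \<le> u \<bullet> y + e"
      by (simp add: inner_diff_right)
  qed
  then have k: "k (x, u) = ereal (u \<bullet> y + e)"
    using ham_le[of x y u] e by (cases "k (x, u)") auto
  \<comment> \<open>Since the Hamiltonian lies below \<open>k (x', u') - u' \<bullet> y\<close> for
    every \<open>u'\<close>, the subgradient inequality in \<open>x\<close> covers all pairs
    \<open>(x', u')\<close> at once.\<close>
  have "conjugate k (v, y) \<le> ereal (x \<bullet> v - e)"
    unfolding conjugate_def
  proof (rule SUP_least)
    fix q :: "'e \<times> 'e"
    obtain x' u' where q: "q = (x', u')"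
      by (cases q)
    have "ereal (e + v \<bullet> (x' - x)) \<le> k (x', u') - ereal (u' \<bullet> y)"
      using sub_x ham_le by (rule order_trans)
    then show "ereal (q \<bullet> (v, y)) - k q \<le> ereal (x \<bullet> v - e)"
      using q by (cases "k (x', u')") (auto simp: inner_diff_right inner_commute)
  qed
  moreover have "ereal (x \<bullet> v - e) \<le> conjugate k (v, y)"
    unfolding conjugate_def by (rule SUP_upper2[of "(x, u)"]) (auto simp: k)
  ultimately have "conjugate k (v, y) = ereal (x \<bullet> v - e)"
    by (rule antisym)
  with k show ?R
    by simp
qed

text \<open>In \<open>ereal\<close> one term \<infinity> makes the whole sum \<infinity>, even next
  to -\<infinity>, so the assumptions pass to every summand. The individual Fenchel slacks are
  nonnegative; their sum vanishes only if each of them does.\<close>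

lemma sum_fenchel_young:
  fixes h :: "'i \<Rightarrow> 'e::real_inner \<Rightarrow> ereal"
  assumes "finite I" "(\<Sum>i\<in>I. h i (z i)) < \<infinity>" "(\<Sum>i\<in>I. conjugate (h i) (v i)) < \<infinity>"
  obtains a b where "(\<Sum>i\<in>I. h i (z i)) = ereal a" "(\<Sum>i\<in>I. conjugate (h i) (v i)) = ereal b"
    "(\<Sum>i\<in>I. z i \<bullet> v i) \<le> a + b"
    "a + b = (\<Sum>i\<in>I. z i \<bullet> v i) \<longleftrightarrow>
      (\<forall>i\<in>I. \<exists>\<alpha> \<beta>. h i (z i) = ereal \<alpha> \<and> conjugate (h i) (v i) = ereal \<beta> \<and> \<alpha> + \<beta> = z i \<bullet> v i)"
proof -
  have "\<exists>\<alpha> \<beta>. h i (z i) = ereal \<alpha> \<and> conjugate (h i) (v i) = ereal \<beta> \<and> z i \<bullet> v i \<le> \<alpha> + \<beta>"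
    if "i \<in> I" for i
  proof -
    have "h i (z i) < \<infinity>" "conjugate (h i) (v i) < \<infinity>"
      using assms that by (auto simp: less_top[symmetric] top_ereal_def sum_Pinfty)
    then show ?thesis
      by (rule fenchel_young) blast
  qed
  then obtain \<alpha> \<beta> where \<alpha>: "\<And>i. i \<in> I \<Longrightarrow> h i (z i) = ereal (\<alpha> i)"
    and \<beta>: "\<And>i. i \<in> I \<Longrightarrow> conjugate (h i) (v i) = ereal (\<beta> i)"
    and le: "\<And>i. i \<in> I \<Longrightarrow> z i \<bullet> v i \<le> \<alpha> i + \<beta> i"
    by metis
  have "sum \<alpha> I + sum \<beta> I = (\<Sum>i\<in>I. z i \<bullet> v i) \<longleftrightarrow> (\<Sum>i\<in>I. \<alpha> i + \<beta> i - z i \<bullet> v i) = 0"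
    by (simp add: sum_subtractf sum.distrib)
  also have "\<dots> \<longleftrightarrow> (\<forall>i\<in>I. \<alpha> i + \<beta> i - z i \<bullet> v i = 0)"
    using assms(1) le by (intro sum_nonneg_eq_0_iff) auto
  also have "\<dots> \<longleftrightarrow> (\<forall>i\<in>I. \<exists>\<alpha> \<beta>. h i (z i) = ereal \<alpha> \<and> conjugate (h i) (v i) = ereal \<beta> \<and> \<alpha> + \<beta> = z i \<bullet> v i)"
    using \<alpha> \<beta> by auto
  finally have eq: "sum \<alpha> I + sum \<beta> I = (\<Sum>i\<in>I. z i \<bullet> v i) \<longleftrightarrow> \<dots>" .
  have "(\<Sum>i\<in>I. h i (z i)) = ereal (sum \<alpha> I)" "(\<Sum>i\<in>I. conjugate (h i) (v i)) = ereal (sum \<beta> I)"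
    using \<alpha> \<beta> by (auto simp flip: sum_ereal)
  moreover have "(\<Sum>i\<in>I. z i \<bullet> v i) \<le> sum \<alpha> I + sum \<beta> I"
    using le by (simp add: sum_mono flip: sum.distrib)
  ultimately show thesis
    using eq by (rule that)
qed

section \<open>Extended expectations and integrability from one-sided bounds\<close>

lemma ext_expectation_cong_AE:
  assumes "AE \<omega> in M. \<phi> \<omega> = \<psi> \<omega>"
  shows "ext_expectation M \<phi> = ext_expectation M \<psi>"
proof -
  have "(\<integral>\<^sup>+\<omega>. e2ennreal (\<phi> \<omega>) \<partial>M) = (\<integral>\<^sup>+\<omega>. e2ennreal (\<psi> \<omega>) \<partial>M)"
    "(\<integral>\<^sup>+\<omega>. e2ennreal (- \<phi> \<omega>) \<partial>M) = (\<integral>\<^sup>+\<omega>. e2ennreal (- \<psi> \<omega>) \<partial>M)"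
    using assms by (auto intro!: nn_integral_cong_AE)
  then show ?thesis
    by (simp add: ext_expectation_def)
qed

lemma ext_expectation_ereal:
  assumes "integrable M f"
  shows "ext_expectation M (\<lambda>\<omega>. ereal (f \<omega>)) = ereal (integral\<^sup>L M f)"
proof -
  obtain a b where ab: "0 \<le> a" "0 \<le> b" "(\<integral>\<^sup>+\<omega>. ennreal (f \<omega>) \<partial>M) = ennreal a" "(\<integral>\<^sup>+\<omega>. ennreal (- f \<omega>) \<partial>M) = ennreal b"
    using assms unfolding real_integrable_def
    by (metis ennreal_cases infinity_ennreal_def)
  have "integral\<^sup>L M f = a - b"
    using real_lebesgue_integral_def[OF assms] ab by simp
  then show ?thesis
    using ab by (simp add: ext_expectation_def enn2ereal_ennreal)
qed

text \<open>The bound is the positive part of \<open>\<phi>\<close>. Nothing is gained from below: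
  the negative part may have infinite integral.\<close>

lemma ext_expectation_less_infinityE:
  assumes [measurable]: "\<phi> \<in> borel_measurable M" and fin: "ext_expectation M \<phi> < \<infinity>"
  obtains g where "integrable M g" "AE \<omega> in M. \<phi> \<omega> \<le> ereal (g \<omega>)"
proof -
  have nn: "(\<integral>\<^sup>+\<omega>. e2ennreal (\<phi> \<omega>) \<partial>M) \<noteq> \<infinity>"
    using fin by (auto simp: ext_expectation_def)
  then have AE: "AE \<omega> in M. e2ennreal (\<phi> \<omega>) \<noteq> \<infinity>"
    by (intro nn_integral_PInf_AE) auto
  then have AE': "AE \<omega> in M. ennreal (enn2real (e2ennreal (\<phi> \<omega>))) = e2ennreal (\<phi> \<omega>)"
    by eventually_elim (simp add: less_top)
  show thesis
  proof
    have "(\<integral>\<^sup>+\<omega>. ennreal (enn2real (e2ennreal (\<phi> \<omega>))) \<partial>M) = (\<integral>\<^sup>+\<omega>. e2ennreal (\<phi> \<omega>) \<partial>M)"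
      using AE' by (rule nn_integral_cong_AE)
    also have "\<dots> < \<infinity>"
      using nn by (simp add: less_top)
    finally show "integrable M (\<lambda>\<omega>. enn2real (e2ennreal (\<phi> \<omega>)))"
      by (intro integrableI_nonneg) auto
    \<comment> \<open>\<open>enn2real\<close> sends \<infinity> to 0, so the bound is valid only
      where the positive part is finite, which is almost everywhere.\<close>
    show "AE \<omega> in M. \<phi> \<omega> \<le> ereal (enn2real (e2ennreal (\<phi> \<omega>)))"
      using AE
    proof eventually_elim
      case (elim \<omega>)
      moreover have "r \<le> enn2real (ennreal r)" for r
        by (cases "0 \<le> r") (auto simp: ennreal_neg)
      ultimately show ?case
        by (cases "\<phi> \<omega>") auto
    qed
  qed
qed

text \<open>Makes the two expectations finite, so that they can be added. The assumption on
  \<open>Z\<close> isolates the probabilistic input, namely that an integrable upper bound already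
  forces integrability.\<close>

lemma ext_expectation_pair:
  fixes Z :: "'a \<Rightarrow> real"
  assumes meas: "\<phi> \<in> borel_measurable M" "\<psi> \<in> borel_measurable M"
    and fin: "ext_expectation M \<phi> < \<infinity>" "ext_expectation M \<psi> < \<infinity>"
    and Z: "\<And>g. integrable M g \<Longrightarrow> AE \<omega> in M. Z \<omega> \<le> g \<omega> \<Longrightarrow> integrable M Z"
    and ge: "AE \<omega> in M. \<phi> \<omega> < \<infinity> \<longrightarrow> \<psi> \<omega> < \<infinity> \<longrightarrow>
      (\<exists>a b. \<phi> \<omega> = ereal a \<and> \<psi> \<omega> = ereal b \<and> Z \<omega> \<le> a + b)"
  obtains f h where "integrable M f" "integrable M h" "integrable M Z"
    "AE \<omega> in M. \<phi> \<omega> = ereal (f \<omega>) \<and> \<psi> \<omega> = ereal (h \<omega>) \<and> Z \<omega> \<le> f \<omega> + h \<omega>"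
proof -
  obtain g1 where g1: "integrable M g1" "AE \<omega> in M. \<phi> \<omega> \<le> ereal (g1 \<omega>)"
    using ext_expectation_less_infinityE[OF meas(1) fin(1)] .
  obtain g2 where g2: "integrable M g2" "AE \<omega> in M. \<psi> \<omega> \<le> ereal (g2 \<omega>)"
    using ext_expectation_less_infinityE[OF meas(2) fin(2)] .
  define f h where "f = (\<lambda>\<omega>. real_of_ereal (\<phi> \<omega>))" and "h = (\<lambda>\<omega>. real_of_ereal (\<psi> \<omega>))"
  have [measurable]: "f \<in> borel_measurable M" "h \<in> borel_measurable M"
    using meas by (simp_all add: f_def h_def)
  have AE: "AE \<omega> in M. \<phi> \<omega> = ereal (f \<omega>) \<and> \<psi> \<omega> = ereal (h \<omega>) \<and> Z \<omega> \<le> f \<omega> + h \<omega> \<and> f \<omega> \<le> g1 \<omega> \<and> h \<omega> \<le> g2 \<omega>"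
    using g1(2) g2(2) ge
  proof eventually_elim
    case (elim \<omega>)
    then have "\<phi> \<omega> < \<infinity>" "\<psi> \<omega> < \<infinity>"
      by (auto intro: le_less_trans)
    with elim show ?case
      by (auto simp: f_def h_def)
  qed
  have iZ: "integrable M Z"
  proof (rule Z)
    show "integrable M (\<lambda>\<omega>. g1 \<omega> + g2 \<omega>)"
      using g1(1) g2(1) by simp
    show "AE \<omega> in M. Z \<omega> \<le> g1 \<omega> + g2 \<omega>"
      using AE by eventually_elim simp
  qed
  \<comment> \<open>Almost surely \<open>Z - g2 \<le> f \<le> g1\<close>, because
    \<open>h \<le> g2\<close> and \<open>Z \<le> f + h\<close>; the argument for \<open>h\<close> is
    symmetric.\<close>
  have "integrable M f"
  proof (rule Bochner_Integration.integrable_bound)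
    show "integrable M (\<lambda>\<omega>. \<bar>g1 \<omega>\<bar> + \<bar>Z \<omega>\<bar> + \<bar>g2 \<omega>\<bar>)"
      using g1(1) g2(1) iZ by simp
    show "AE \<omega> in M. norm (f \<omega>) \<le> norm (\<bar>g1 \<omega>\<bar> + \<bar>Z \<omega>\<bar> + \<bar>g2 \<omega>\<bar>)"
      using AE by eventually_elim auto
  qed simp
  moreover have "integrable M h"
  proof (rule Bochner_Integration.integrable_bound)
    show "integrable M (\<lambda>\<omega>. \<bar>g1 \<omega>\<bar> + \<bar>Z \<omega>\<bar> + \<bar>g2 \<omega>\<bar>)"
      using g1(1) g2(1) iZ by simp
    show "AE \<omega> in M. norm (h \<omega>) \<le> norm (\<bar>g1 \<omega>\<bar> + \<bar>Z \<omega>\<bar> + \<bar>g2 \<omega>\<bar>)"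
      using AE by eventually_elim auto
  qed simp
  moreover have "AE \<omega> in M. \<phi> \<omega> = ereal (f \<omega>) \<and> \<psi> \<omega> = ereal (h \<omega>) \<and> Z \<omega> \<le> f \<omega> + h \<omega>"
    using AE by eventually_elim auto
  ultimately show thesis
    using iZ that by blast
qed

lemma integrable_mean_zero_truncations:
  fixes Z g :: "'a \<Rightarrow> real"
  assumes [measurable]: "Z \<in> borel_measurable M" "\<And>n. A n \<in> sets M"
    and g: "integrable M g" "AE \<omega> in M. Z \<omega> \<le> g \<omega>"
    and A: "incseq A" "(\<Union>n. A n) = space M"
    and trunc: "\<And>n. integrable M (\<lambda>\<omega>. indicator (A n) \<omega> * Z \<omega>)"
      "\<And>n. (LINT \<omega>|M. indicator (A n) \<omega> * Z \<omega>) = 0"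
  shows "integrable M Z" "integral\<^sup>L M Z = 0"
proof -
  \<comment> \<open>Monotone convergence applies to the truncations of \<open>g - Z\<close>, whose integrals are
    those of the truncations of \<open>g\<close>.\<close>
  define h where "h = (\<lambda>n \<omega>. indicator (A n) \<omega> * (g \<omega> - Z \<omega>))"
  have int_g: "integrable M (\<lambda>\<omega>. indicator (A n) \<omega> * g \<omega>)" for n
    using integrable_mult_indicator[OF _ g(1)] by simp
  have h_eq: "h n = (\<lambda>\<omega>. indicator (A n) \<omega> * g \<omega> - indicator (A n) \<omega> * Z \<omega>)" for n
    by (simp add: h_def right_diff_distrib)
  have eventually_in: "\<forall>\<^sub>F n in sequentially. \<omega> \<in> A n" if "\<omega> \<in> space M" for \<omega>
  proof -
    have "\<omega> \<in> (\<Union>n. A n)"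
      using A(2) that by simp
    then obtain N where "\<omega> \<in> A N"
      by blast
    then have "\<omega> \<in> A n" if "N \<le> n" for n
      using incseqD[OF A(1) that] by blast
    then show ?thesis
      by (auto simp: eventually_sequentially)
  qed
  have lim_ind: "(\<lambda>n. indicator (A n) \<omega> * c) \<longlonglongrightarrow> c" if "\<omega> \<in> space M" for \<omega> and c :: real
    by (intro tendsto_eventually eventually_mono[OF eventually_in[OF that]]) simp
  have int_h: "integrable M (h n)" for n
    unfolding h_eq using int_g trunc(1) by (rule Bochner_Integration.integrable_diff)
  \<comment> \<open>The upper bound makes \<open>g - Z\<close> nonnegative almost everywhere, so
    enlarging the event increases the truncation.\<close>
  have mono: "AE \<omega> in M. mono (\<lambda>n. h n \<omega>)"
    using g(2)
  proof eventually_elim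
    case (elim \<omega>)
    show ?case
    proof (rule monoI)
      fix m n :: nat assume "m \<le> n"
      then have "A m \<subseteq> A n"
        using A(1) by (rule incseqD[rotated])
      then show "h m \<omega> \<le> h n \<omega>"
        using elim by (auto simp: h_def indicator_def)
    qed
  qed
  have lim: "AE \<omega> in M. (\<lambda>n. h n \<omega>) \<longlonglongrightarrow> g \<omega> - Z \<omega>"
    unfolding h_def by (intro AE_I2 lim_ind)
  have "(\<lambda>n. LINT \<omega>|M. indicator (A n) \<omega> * g \<omega>) \<longlonglongrightarrow> integral\<^sup>L M g"
  proof (rule integral_dominated_convergence[where w = "\<lambda>\<omega>. \<bar>g \<omega>\<bar>"])
    show "AE \<omega> in M. (\<lambda>n. indicator (A n) \<omega> * g \<omega>) \<longlonglongrightarrow> g \<omega>"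
      by (intro AE_I2 lim_ind)
    show "AE \<omega> in M. norm (indicator (A n) \<omega> * g \<omega>) \<le> \<bar>g \<omega>\<bar>" for n
      by (intro AE_I2) (auto simp: indicator_def)
  qed (use g(1) in auto)
  moreover have "integral\<^sup>L M (h n) = (LINT \<omega>|M. indicator (A n) \<omega> * g \<omega>)" for n
    unfolding h_eq using int_g trunc by simp
  ultimately have lim_int: "(\<lambda>n. integral\<^sup>L M (h n)) \<longlonglongrightarrow> integral\<^sup>L M g"
    by simp
  have meas: "(\<lambda>\<omega>. g \<omega> - Z \<omega>) \<in> borel_measurable M"
    using g(1) by measurable
  have diff: "integrable M (\<lambda>\<omega>. g \<omega> - Z \<omega>)" "(LINT \<omega>|M. g \<omega> - Z \<omega>) = integral\<^sup>L M g"
    using integrable_monotone_convergence[OF int_h mono lim lim_int meas]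
      integral_monotone_convergence[OF int_h mono lim lim_int meas] by simp_all
  have Z: "Z = (\<lambda>\<omega>. g \<omega> - (g \<omega> - Z \<omega>))"
    by simp
  show "integrable M Z"
    by (subst Z) (intro Bochner_Integration.integrable_diff g(1) diff(1))
  show "integral\<^sup>L M Z = 0"
    using Bochner_Integration.integral_diff[OF g(1) diff(1)] diff(2) by simp
qed

section \<open>Orthogonality to adapted processes beyond the bounded ones\<close>

text \<open>An event of \<open>F s\<close> belongs to every later \<open>F t\<close>, so multiplying
  by its indicator from time \<open>s\<close> on preserves adaptedness. Before \<open>s\<close> the
  event need not be known, hence the value 0 there.\<close>

lemma adapted_scale_indicator:
  assumes "finite_filtration M T F" "x \<in> adapted M T F" "s \<le> T" "A \<in> sets (F s)"
  shows "(\<lambda>t \<omega>. if s \<le> t then indicator A \<omega> *\<^sub>R x t \<omega> else 0) \<in> adapted M T F"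
  unfolding adapted_def
proof (intro CollectI allI impI)
  fix t assume t: "t \<le> T"
  have sub: "subalgebra M (F t)"
    using assms(1) t by (auto simp: finite_filtration_def)
  have x: "x t \<in> borel_measurable M"
    using assms(2) t by (auto simp: adapted_def)
  obtain x' where x': "x' \<in> borel_measurable (F t)" "AE \<omega> in M. x t \<omega> = x' \<omega>"
    using assms(2) t by (auto simp: adapted_def)
  show "(\<lambda>\<omega>. if s \<le> t then indicator A \<omega> *\<^sub>R x t \<omega> else 0) \<in> borel_measurable M \<and>
    (\<exists>x'\<in>borel_measurable (F t). AE \<omega> in M. (if s \<le> t then indicator A \<omega> *\<^sub>R x t \<omega> else 0) = x' \<omega>)"
  proof (cases "s \<le> t")
    case True
    have "sets (F s) \<subseteq> sets (F t)"
      using assms(1) True t by (simp add: finite_filtration_def)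
    moreover have "sets (F t) \<subseteq> sets M"
      using sub by (simp add: subalgebra_def)
    ultimately have A: "A \<in> sets (F t)" "A \<in> sets M"
      using assms(4) by blast+
    show ?thesis
    proof (intro conjI bexI[of _ "\<lambda>\<omega>. indicator A \<omega> *\<^sub>R x' \<omega>"])
      show "(\<lambda>\<omega>. if s \<le> t then indicator A \<omega> *\<^sub>R x t \<omega> else 0) \<in> borel_measurable M"
        using True A(2) x by simp
      show "AE \<omega> in M. (if s \<le> t then indicator A \<omega> *\<^sub>R x t \<omega> else 0) = indicator A \<omega> *\<^sub>R x' \<omega>"
        using x'(2) True by auto
      show "(\<lambda>\<omega>. indicator A \<omega> *\<^sub>R x' \<omega>) \<in> borel_measurable (F t)"
        using A(1) x'(1) by simp
    qed
  next
    case False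
    then show ?thesis
      by (intro conjI bexI[of _ "\<lambda>_. 0"]) auto
  qed
qed

locale process_duality =
  fixes M :: "'a measure" and T :: nat and F :: "nat \<Rightarrow> 'a measure"
    and S S' :: "('a \<Rightarrow> real ^ 'd::finite) set"
  assumes filtration: "finite_filtration M T F"
    and S_linear: "rv_linear_space M S" and S_decomposable: "decomposable M S"
    and S'_linear: "rv_linear_space M S'"
    and duality: "separating_duality M S S'"
begin

lemma Linfty_subset: "Linfty M \<subseteq> S"
proof
  fix u :: "'a \<Rightarrow> real ^ 'd" assume u: "u \<in> Linfty M"
  have zero: "(\<lambda>_. 0) \<in> S"
    using S_linear by (simp add: rv_linear_space_def)
  \<comment> \<open>Decomposability for the empty event: the pasted variable is \<open>u\<close>
    everywhere.\<close>
  have "(\<lambda>\<omega>. if \<omega> \<in> {} then 0 else u \<omega>) \<in> S"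
    using S_decomposable[unfolded decomposable_def, rule_format, OF zero u sets.empty_sets] .
  then show "u \<in> S"
    by simp
qed

text \<open>Bounded variables lie in \<open>S\<close>, so the process with value \<open>z\<close> at
  time \<open>s\<close> and 0 at all other times may be tested against \<open>p\<close>. This yields
  orthogonality separately at each time.\<close>

lemma adapted_perp_bounded:
  assumes p: "p \<in> adapted_perp M T F S S'" and s: "s \<le> T" and z: "z \<in> borel_measurable M"
    and z': "z' \<in> borel_measurable (F s)" "AE \<omega> in M. z \<omega> = z' \<omega>" and bound: "AE \<omega> in M. norm (z \<omega>) \<le> C"
  shows "integrable M (\<lambda>\<omega>. z \<omega> \<bullet> p s \<omega>)" "(LINT \<omega>|M. z \<omega> \<bullet> p s \<omega>) = 0"
proof -
  have zS: "z \<in> S"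
    using Linfty_subset z bound by (auto simp: Linfty_def)
  have "p s \<in> S'"
    using p s by (auto simp: adapted_perp_def processes_in_def)
  with zS show "integrable M (\<lambda>\<omega>. z \<omega> \<bullet> p s \<omega>)"
    using duality by (auto simp: separating_duality_def)
  define w where "w = (\<lambda>t. if t = s then z else (\<lambda>_. 0))"
  have "w \<in> processes_in T S"
    using zS S_linear by (auto simp: w_def processes_in_def rv_linear_space_def)
  moreover have "w \<in> adapted M T F"
    unfolding adapted_def
  proof (intro CollectI allI impI)
    fix t assume "t \<le> T"
    show "w t \<in> borel_measurable M \<and> (\<exists>x'\<in>borel_measurable (F t). AE \<omega> in M. w t \<omega> = x' \<omega>)"
    proof (cases "t = s")
      case True
      then show ?thesis
        using z z' by (auto simp: w_def)
    next
      case False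
      then show ?thesis
        by (auto simp: w_def intro!: bexI[of _ "\<lambda>_. 0"])
    qed
  qed
  ultimately have "(LINT \<omega>|M. (\<Sum>t\<le>T. w t \<omega> \<bullet> p t \<omega>)) = 0"
    using p by (auto simp: adapted_perp_def)
  also have "(\<lambda>\<omega>. \<Sum>t\<le>T. w t \<omega> \<bullet> p t \<omega>) = (\<lambda>\<omega>. z \<omega> \<bullet> p s \<omega>)"
  proof
    fix \<omega>
    have "(\<Sum>t\<le>T. w t \<omega> \<bullet> p t \<omega>) = (\<Sum>t\<le>T. if t = s then z \<omega> \<bullet> p s \<omega> else 0)"
      by (rule sum.cong) (auto simp: w_def)
    then show "(\<Sum>t\<le>T. w t \<omega> \<bullet> p t \<omega>) = z \<omega> \<bullet> p s \<omega>"
      using s by simp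
  qed
  finally show "(LINT \<omega>|M. z \<omega> \<bullet> p s \<omega>) = 0" .
qed

text \<open>As for local martingales, an integrable upper bound suffices: truncate on the
  \<open>\<F>\<^sub>s\<close>-measurable events where the first term \<open>x\<^sub>s\<close> is bounded by \<open>n\<close>, and proceed by
  backward induction on the initial time.\<close>

lemma adapted_perp_integral_from:
  fixes x :: "('a, 'd) process"
  assumes p: "p \<in> adapted_perp M T F S S'" and "s \<le> Suc T" and "x \<in> adapted M T F"
    and "integrable M g" "AE \<omega> in M. (\<Sum>t\<in>{s..T}. x t \<omega> \<bullet> p t \<omega>) \<le> g \<omega>"
  shows "integrable M (\<lambda>\<omega>. \<Sum>t\<in>{s..T}. x t \<omega> \<bullet> p t \<omega>) \<and>
    (LINT \<omega>|M. (\<Sum>t\<in>{s..T}. x t \<omega> \<bullet> p t \<omega>)) = 0"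
  using assms(2-)
\<comment> \<open>The base is the empty sum at \<open>Suc T\<close>. Both \<open>x\<close> and
  \<open>g\<close> vary because the hypothesis is applied to a truncated process with a corrected
  bound.\<close>
proof (induction s arbitrary: x g rule: inc_induct)
  case base
  then show ?case by simp
next
  case (step s)
  then have s: "s \<le> T"
    by simp
  have x_meas: "x t \<in> borel_measurable M" if "t \<le> T" for t
    using step.prems(1) that by (auto simp: adapted_def)
  have p_meas: "p t \<in> borel_measurable M" if "t \<le> T" for t
    using p that S'_linear by (auto simp: adapted_perp_def processes_in_def rv_linear_space_def)
  obtain x' where x': "x' \<in> borel_measurable (F s)" "AE \<omega> in M. x s \<omega> = x' \<omega>"
    using step.prems(1) s by (auto simp: adapted_def)
  have sub: "subalgebra M (F s)"
    using filtration s by (auto simp: finite_filtration_def)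
  \<comment> \<open>The version \<open>x'\<close> is used because \<open>x s\<close> itself is
    \<open>F s\<close>-measurable only up to a null set.\<close>
  define A where "A n = {\<omega>\<in>space (F s). norm (x' \<omega>) \<le> real n}" for n
  have AF: "A n \<in> sets (F s)" for n
    unfolding A_def using x'(1) by measurable
  then have AM: "A n \<in> sets M" for n
    using sub by (auto simp: subalgebra_def)
  define Z where "Z = (\<lambda>\<omega>. \<Sum>t\<in>{s..T}. x t \<omega> \<bullet> p t \<omega>)"
  have split: "Z \<omega> = x s \<omega> \<bullet> p s \<omega> + (\<Sum>t\<in>{Suc s..T}. x t \<omega> \<bullet> p t \<omega>)" for \<omega>
    unfolding Z_def using s by (rule sum.atLeast_Suc_atMost)
  have Z_meas: "Z \<in> borel_measurable M"
    unfolding Z_def using x_meas p_meas by (intro borel_measurable_sum borel_measurable_inner) auto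
  have trunc: "integrable M (\<lambda>\<omega>. indicator (A n) \<omega> * Z \<omega>) \<and> (LINT \<omega>|M. indicator (A n) \<omega> * Z \<omega>) = 0" for n
  proof -
    define z where "z = (\<lambda>\<omega>. indicator (A n) \<omega> *\<^sub>R x s \<omega>)"
    have "AE \<omega> in M. z \<omega> = indicator (A n) \<omega> *\<^sub>R x' \<omega>"
      using x'(2) by (auto simp: z_def)
    moreover have "(\<lambda>\<omega>. indicator (A n) \<omega> *\<^sub>R x' \<omega>) \<in> borel_measurable (F s)"
      using x'(1) AF by simp
    moreover have "z \<in> borel_measurable M"
      using x_meas[OF s] AM by (simp add: z_def)
    moreover have "AE \<omega> in M. norm (z \<omega>) \<le> real n"
      using x'(2) by eventually_elim (auto simp: z_def A_def indicator_def)
    ultimately have first: "integrable M (\<lambda>\<omega>. z \<omega> \<bullet> p s \<omega>)" "(LINT \<omega>|M. z \<omega> \<bullet> p s \<omega>) = 0"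
      using adapted_perp_bounded[OF p s] by blast+
    define w where "w = (\<lambda>t \<omega>. if s \<le> t then indicator (A n) \<omega> *\<^sub>R x t \<omega> else 0)"
    have w: "w \<in> adapted M T F"
      unfolding w_def using adapted_scale_indicator[OF filtration step.prems(1) s AF] .
    have eq: "indicator (A n) \<omega> * Z \<omega> = z \<omega> \<bullet> p s \<omega> + (\<Sum>t\<in>{Suc s..T}. w t \<omega> \<bullet> p t \<omega>)" for \<omega>
      unfolding split by (simp add: z_def w_def distrib_left sum_distrib_left)
    \<comment> \<open>This is the upper bound for the tail: on \<open>A n\<close> the tail is
      \<open>Z\<close> minus the first term, and that term is integrable because \<open>x s\<close>
      is almost surely bounded there.\<close>
    have "integrable M (\<lambda>\<omega>. indicator (A n) \<omega> * g \<omega> - z \<omega> \<bullet> p s \<omega>)"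
      using integrable_mult_indicator[OF AM step.prems(2)] first(1) by simp
    moreover have "AE \<omega> in M. (\<Sum>t\<in>{Suc s..T}. w t \<omega> \<bullet> p t \<omega>) \<le> indicator (A n) \<omega> * g \<omega> - z \<omega> \<bullet> p s \<omega>"
      using step.prems(3)
    proof eventually_elim
      case (elim \<omega>)
      then have "indicator (A n) \<omega> * Z \<omega> \<le> indicator (A n) \<omega> * g \<omega>"
        unfolding Z_def by (intro mult_left_mono) auto
      then show ?case
        using eq[of \<omega>] by simp
    qed
    ultimately have "integrable M (\<lambda>\<omega>. \<Sum>t\<in>{Suc s..T}. w t \<omega> \<bullet> p t \<omega>) \<and>
        (LINT \<omega>|M. (\<Sum>t\<in>{Suc s..T}. w t \<omega> \<bullet> p t \<omega>)) = 0"
      by (intro step.IH[OF w])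
    then show ?thesis
      unfolding eq using first by simp
  qed
  have "incseq A"
    by (intro incseq_SucI) (auto simp: A_def)
  moreover have "(\<Union>n. A n) = space M"
    using sub real_arch_simple by (auto simp: A_def subalgebra_def)
  ultimately show ?case
    using integrable_mean_zero_truncations[of Z M A g] Z_meas AM trunc step.prems(2,3)
    unfolding Z_def by blast
qed

lemma adapted_perp_integral:
  fixes x :: "('a, 'd) process"
  assumes "p \<in> adapted_perp M T F S S'" "x \<in> adapted M T F"
    and "integrable M g" "AE \<omega> in M. (\<Sum>t\<le>T. x t \<omega> \<bullet> p t \<omega>) \<le> g \<omega>"
  shows "integrable M (\<lambda>\<omega>. \<Sum>t\<le>T. x t \<omega> \<bullet> p t \<omega>)" "(LINT \<omega>|M. (\<Sum>t\<le>T. x t \<omega> \<bullet> p t \<omega>)) = 0"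
  using adapted_perp_integral_from[of p 0 x g] assms by (simp_all add: atMost_atLeast0)

end

section \<open>Weak duality and optimality for the problem of Lagrange\<close>

text \<open>Without \<open>p\<close>, the summand at \<open>t\<close> is x_t . y_{t+1} - x_{t-1} .
  y_t, so partial sums telescope to x_n . y_{n+1}. The conventions x_{-1} = 0 and y_{T+1} = 0 remove
  the two boundary terms.\<close>

lemma summation_by_parts:
  fixes x y :: "('a, 'd::finite) process"
  shows "(\<Sum>t\<le>T. (x t \<omega>, bdiff x t \<omega>) \<bullet> (p t \<omega> + fdiff T y t \<omega>, y t \<omega>)) = (\<Sum>t\<le>T. x t \<omega> \<bullet> p t \<omega>)"
proof -
  have "(\<Sum>t\<le>n. x t \<omega> \<bullet> fdiff T y t \<omega> + bdiff x t \<omega> \<bullet> y t \<omega>) = x n \<omega> \<bullet> (if n = T then 0 else y (Suc n) \<omega>)"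
    if "n \<le> T" for n
    using that
    by (induction n) (auto simp: fdiff_def bdiff_def inner_diff_left inner_diff_right)
  from this[of T] show ?thesis
    by (simp add: inner_add_right sum.distrib)
qed

locale lagrange_problem = process_duality M T F S S'
  for M :: "'a measure" and T F and S S' :: "('a \<Rightarrow> real ^ 'd::finite) set" +
  fixes K :: "('a, 'd) lagrangian"
  assumes normal: "\<And>t. t \<le> T \<Longrightarrow> convex_normal_integrand M (K t)"
begin

text \<open>\<open>\<delta>\<close> is the total Fenchel slack \<open>f + h - Z\<close>, where
  \<open>f\<close> and \<open>h\<close> are real versions of the two cost integrands. As
  \<open>Z\<close> has mean zero, the integral of the slack is the sum of the primal and the dual
  cost.\<close>

lemma feasible_pair:
  assumes x: "x \<in> adapted M T F" and py: "(p, y) \<in> dual_domain M T F S S'"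
    and fin: "primal_obj M T K x < \<infinity>" "dual_cost M T K (p, y) < \<infinity>"
  obtains \<delta> where "integrable M \<delta>" "AE \<omega> in M. 0 \<le> \<delta> \<omega>"
    "primal_obj M T K x + dual_cost M T K (p, y) = ereal (integral\<^sup>L M \<delta>)"
    "\<bar>primal_obj M T K x\<bar> \<noteq> \<infinity>" "\<bar>dual_cost M T K (p, y)\<bar> \<noteq> \<infinity>"
    "AE \<omega> in M. \<delta> \<omega> = 0 \<longleftrightarrow> (\<forall>t\<le>T.
       p t \<omega> + fdiff T y t \<omega>
         \<in> subdifferential (\<lambda>x'. hamiltonian (K t \<omega>) x' (y t \<omega>)) (x t \<omega>) \<and>
       bdiff x t \<omega>
         \<in> subdifferential (\<lambda>y'. - hamiltonian (K t \<omega>) (x t \<omega>) y') (y t \<omega>))"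
proof -
  define \<phi> where "\<phi> = (\<lambda>\<omega>. \<Sum>t\<le>T. K t \<omega> (x t \<omega>, bdiff x t \<omega>))"
  define \<psi> where "\<psi> = (\<lambda>\<omega>. \<Sum>t\<le>T. conjugate (K t \<omega>) (p t \<omega> + fdiff T y t \<omega>, y t \<omega>))"
  define Z where "Z = (\<lambda>\<omega>. \<Sum>t\<le>T. x t \<omega> \<bullet> p t \<omega>)"
  have p: "p \<in> adapted_perp M T F S S'" and y: "\<And>t. t \<le> T \<Longrightarrow> y t \<in> S'"
    using py by (auto simp: dual_domain_def processes_in_def)
  have x_meas: "x t \<in> borel_measurable M" if "t \<le> T" for t
    using x that by (auto simp: adapted_def)
  have p_meas: "p t \<in> borel_measurable M" if "t \<le> T" for t
    using p that S'_linear by (auto simp: adapted_perp_def processes_in_def rv_linear_space_def)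
  have y_meas: "y t \<in> borel_measurable M" if "t \<le> T" for t
    using y[OF that] S'_linear by (auto simp: rv_linear_space_def)
  have bdiff_meas: "bdiff x t \<in> borel_measurable M" if "t \<le> T" for t
    using x_meas[OF that] x_meas[of "t - 1"] that
    by (cases "t = 0") (simp_all add: bdiff_def[abs_def])
  have fdiff_meas: "fdiff T y t \<in> borel_measurable M" if "t \<le> T" for t
    using y_meas[OF that] y_meas[of "t + 1"] that
    by (cases "t = T") (simp_all add: fdiff_def[abs_def])
  have \<phi>_meas: "\<phi> \<in> borel_measurable M"
    unfolding \<phi>_def
    by (intro borel_measurable_ereal_sum borel_measurable_normal_integrand normal
        borel_measurable_Pair x_meas bdiff_meas) simp_all
  have \<psi>_meas: "\<psi> \<in> borel_measurable M"
    unfolding \<psi>_def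
    by (intro borel_measurable_ereal_sum borel_measurable_conjugate_normal_integrand normal
        borel_measurable_Pair borel_measurable_add p_meas y_meas fdiff_meas) simp_all
  have pointwise: "\<exists>a b. \<phi> \<omega> = ereal a \<and> \<psi> \<omega> = ereal b \<and> Z \<omega> \<le> a + b \<and>
      (a + b = Z \<omega> \<longleftrightarrow> (\<forall>t\<le>T.
       p t \<omega> + fdiff T y t \<omega>
         \<in> subdifferential (\<lambda>x'. hamiltonian (K t \<omega>) x' (y t \<omega>)) (x t \<omega>) \<and>
       bdiff x t \<omega>
         \<in> subdifferential (\<lambda>y'. - hamiltonian (K t \<omega>) (x t \<omega>) y') (y t \<omega>)))"
    if \<omega>: "\<omega> \<in> space M" and less: "\<phi> \<omega> < \<infinity>" "\<psi> \<omega> < \<infinity>" for \<omega>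
  proof -
    obtain a b where ab: "\<phi> \<omega> = ereal a" "\<psi> \<omega> = ereal b" "Z \<omega> \<le> a + b"
      "a + b = Z \<omega> \<longleftrightarrow> (\<forall>t\<in>{..T}. \<exists>\<alpha> \<beta>. K t \<omega> (x t \<omega>, bdiff x t \<omega>) = ereal \<alpha> \<and>
        conjugate (K t \<omega>) (p t \<omega> + fdiff T y t \<omega>, y t \<omega>) = ereal \<beta> \<and>
        \<alpha> + \<beta> = (x t \<omega>, bdiff x t \<omega>) \<bullet> (p t \<omega> + fdiff T y t \<omega>, y t \<omega>))"
      using less unfolding \<phi>_def \<psi>_def Z_def summation_by_parts[symmetric, where y = y]
      by (rule sum_fenchel_young[OF finite_atMost])
    have "closed_fun (K t \<omega>)" "convex_fun (K t \<omega>)" if "t \<le> T" for t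
      using convex_normal_integrandD[OF normal[OF that]] \<omega> by auto
    note ham = subgradients_hamiltonian_iff[OF this]
    show ?thesis
      using ab by (auto simp: ham)
  qed
  have fin': "ext_expectation M \<phi> < \<infinity>" "ext_expectation M \<psi> < \<infinity>"
    using fin by (simp_all add: primal_obj_def dual_cost_def \<phi>_def \<psi>_def)
  obtain f h where f: "integrable M f" and h: "integrable M h" and Z: "integrable M Z"
    and AE: "AE \<omega> in M. \<phi> \<omega> = ereal (f \<omega>) \<and> \<psi> \<omega> = ereal (h \<omega>) \<and> Z \<omega> \<le> f \<omega> + h \<omega>"
  proof (rule ext_expectation_pair[OF \<phi>_meas \<psi>_meas fin'])
    \<comment> \<open>Orthogonality of \<open>p\<close> enters here: it upgrades the one-sided bound
      to integrability.\<close>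
    show "integrable M Z" if "integrable M g" "AE \<omega> in M. Z \<omega> \<le> g \<omega>" for g
      using adapted_perp_integral(1)[OF p x] that unfolding Z_def by blast
    show "AE \<omega> in M. \<phi> \<omega> < \<infinity> \<longrightarrow> \<psi> \<omega> < \<infinity> \<longrightarrow>
      (\<exists>a b. \<phi> \<omega> = ereal a \<and> \<psi> \<omega> = ereal b \<and> Z \<omega> \<le> a + b)"
      using pointwise by (intro AE_I2) blast
  qed
  \<comment> \<open>Being integrable by now, \<open>Z\<close> serves as its own upper bound.\<close>
  have Z0: "integral\<^sup>L M Z = 0"
    using adapted_perp_integral(2)[OF p x Z[unfolded Z_def]] by (simp add: Z_def)
  have obj: "primal_obj M T K x = ereal (integral\<^sup>L M f)"
    using ext_expectation_cong_AE[where \<phi> = \<phi> and \<psi> = "\<lambda>\<omega>. ereal (f \<omega>)"] AE ext_expectation_ereal[OF f]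
    by (auto simp: primal_obj_def \<phi>_def[symmetric])
  have cost: "dual_cost M T K (p, y) = ereal (integral\<^sup>L M h)"
    using ext_expectation_cong_AE[where \<phi> = \<psi> and \<psi> = "\<lambda>\<omega>. ereal (h \<omega>)"] AE ext_expectation_ereal[OF h]
    by (auto simp: dual_cost_def \<psi>_def[symmetric])
  show thesis
  proof
    show "integrable M (\<lambda>\<omega>. f \<omega> + h \<omega> - Z \<omega>)"
      using f h Z by simp
    show "AE \<omega> in M. 0 \<le> f \<omega> + h \<omega> - Z \<omega>"
      using AE by eventually_elim simp
    show "primal_obj M T K x + dual_cost M T K (p, y) = ereal (LINT \<omega>|M. f \<omega> + h \<omega> - Z \<omega>)"
      using f h Z Z0 by (simp add: obj cost)
    show "AE \<omega> in M. f \<omega> + h \<omega> - Z \<omega> = 0 \<longleftrightarrow> (\<forall>t\<le>T.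
       p t \<omega> + fdiff T y t \<omega>
         \<in> subdifferential (\<lambda>x'. hamiltonian (K t \<omega>) x' (y t \<omega>)) (x t \<omega>) \<and>
       bdiff x t \<omega>
         \<in> subdifferential (\<lambda>y'. - hamiltonian (K t \<omega>) (x t \<omega>) y') (y t \<omega>))"
      using AE AE_space
    proof eventually_elim
      case (elim \<omega>)
      then obtain a b where "\<phi> \<omega> = ereal a" "\<psi> \<omega> = ereal b"
        and iff: "a + b = Z \<omega> \<longleftrightarrow> (\<forall>t\<le>T.
          p t \<omega> + fdiff T y t \<omega>
            \<in> subdifferential (\<lambda>x'. hamiltonian (K t \<omega>) x' (y t \<omega>)) (x t \<omega>) \<and>
          bdiff x t \<omega>
            \<in> subdifferential (\<lambda>y'. - hamiltonian (K t \<omega>) (x t \<omega>) y') (y t \<omega>))"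
        using pointwise[of \<omega>] by auto
      then have "a = f \<omega>" "b = h \<omega>"
        using elim by auto
      with iff show ?case
        by simp
    qed
  qed (simp_all add: obj cost)
qed

text \<open>If one of the two costs is \<infinity>, the inequality is trivial. Otherwise both are
  finite and their sum is the integral of a nonnegative slack.\<close>

lemma weak_duality: "dual_value M T F S S' K \<le> primal_value M T F K"
  unfolding dual_value_def primal_value_def
proof (intro SUP_least INF_greatest)
  fix py :: "('a, 'd) process \<times> ('a, 'd) process" and x :: "('a, 'd) process"
  assume py: "py \<in> dual_domain M T F S S'" and x: "x \<in> adapted M T F"
  obtain p y where eq: "py = (p, y)"
    by (cases py)
  show "- dual_cost M T K py \<le> primal_obj M T K x"
  proof (cases "primal_obj M T K x < \<infinity> \<and> dual_cost M T K py < \<infinity>")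
    case True
    obtain \<delta> where "AE \<omega> in M. 0 \<le> \<delta> \<omega>"
      "primal_obj M T K x + dual_cost M T K py = ereal (integral\<^sup>L M \<delta>)"
      "\<bar>primal_obj M T K x\<bar> \<noteq> \<infinity>" "\<bar>dual_cost M T K py\<bar> \<noteq> \<infinity>"
      using True by (elim conjE, unfold eq, elim feasible_pair[OF x py[unfolded eq]])
    then show ?thesis
      using integral_nonneg_AE[of \<delta> M]
      by (cases "primal_obj M T K x"; cases "dual_cost M T K py") auto
  next
    case False
    then show ?thesis
      by auto
  qed
qed

text \<open>The dual objective, the dual value, the primal value and the primal objective form an
  increasing chain, so equality of its ends forces equality throughout.\<close>

lemma solves_iff_zero_gap:
  "primal_solves M T F K x \<and> dual_solves M T F S S' K py \<and>
      primal_value M T F K = dual_value M T F S S' K \<longleftrightarrow>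
    primal_feasible M T F K x \<and> dual_feasible M T F S S' K py \<and>
      primal_obj M T K x = - dual_cost M T K py"
proof -
  have primal: "primal_value M T F K \<le> primal_obj M T K x" if "primal_feasible M T F K x"
    using that unfolding primal_feasible_def primal_value_def by (intro INF_lower) simp
  have dual: "- dual_cost M T K py \<le> dual_value M T F S S' K" if "dual_feasible M T F S S' K py"
    using that unfolding dual_feasible_def dual_value_def by (intro SUP_upper) simp
  show ?thesis
  proof
    assume "primal_solves M T F K x \<and> dual_solves M T F S S' K py \<and>
      primal_value M T F K = dual_value M T F S S' K"
    then show "primal_feasible M T F K x \<and> dual_feasible M T F S S' K py \<and>
      primal_obj M T K x = - dual_cost M T K py"
      by (simp add: primal_solves_def dual_solves_def)
  next
    assume R: "primal_feasible M T F K x \<and> dual_feasible M T F S S' K py \<and>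
      primal_obj M T K x = - dual_cost M T K py"
    then have "primal_value M T F K \<le> primal_obj M T K x" "primal_obj M T K x \<le> dual_value M T F S S' K"
      using primal dual by simp_all
    with weak_duality have "primal_obj M T K x = primal_value M T F K"
      "primal_value M T F K = dual_value M T F S S' K"
      by (metis order_antisym order_trans)+
    with R show "primal_solves M T F K x \<and> dual_solves M T F S S' K py \<and>
      primal_value M T F K = dual_value M T F S S' K"
      by (simp add: primal_solves_def dual_solves_def)
  qed
qed

lemma optimality_conditions:
  "primal_solves M T F K x \<and> dual_solves M T F S S' K (p, y) \<and>
      primal_value M T F K = dual_value M T F S S' K
   \<longleftrightarrow>
   primal_feasible M T F K x \<and> dual_feasible M T F S S' K (p, y) \<and>
     (AE \<omega> in M. \<forall>t\<le>T.
        p t \<omega> + fdiff T y t \<omega>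
          \<in> subdifferential (\<lambda>x'. hamiltonian (K t \<omega>) x' (y t \<omega>)) (x t \<omega>) \<and>
        bdiff x t \<omega>
          \<in> subdifferential (\<lambda>y'. - hamiltonian (K t \<omega>) (x t \<omega>) y') (y t \<omega>))"
  (is "_ \<longleftrightarrow> _ \<and> _ \<and> (AE \<omega> in M. ?ham \<omega>)")
proof -
  have "primal_obj M T K x = - dual_cost M T K (p, y) \<longleftrightarrow> (AE \<omega> in M. ?ham \<omega>)"
    if feas: "primal_feasible M T F K x" "dual_feasible M T F S S' K (p, y)"
  proof -
    obtain \<delta> where \<delta>: "integrable M \<delta>" "AE \<omega> in M. 0 \<le> \<delta> \<omega>"
      "primal_obj M T K x + dual_cost M T K (p, y) = ereal (integral\<^sup>L M \<delta>)"
      "\<bar>primal_obj M T K x\<bar> \<noteq> \<infinity>" "\<bar>dual_cost M T K (p, y)\<bar> \<noteq> \<infinity>"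
      and ham: "AE \<omega> in M. \<delta> \<omega> = 0 \<longleftrightarrow> ?ham \<omega>"
      using feas unfolding primal_feasible_def dual_feasible_def
      by (elim conjE) (rule feasible_pair)
    \<comment> \<open>Finiteness of both costs is what allows moving the dual cost to the other side
      in \<open>ereal\<close>.\<close>
    have "primal_obj M T K x = - dual_cost M T K (p, y) \<longleftrightarrow> integral\<^sup>L M \<delta> = 0"
      using \<delta>(3-5) by (cases "primal_obj M T K x"; cases "dual_cost M T K (p, y)") auto
    also have "\<dots> \<longleftrightarrow> (AE \<omega> in M. \<delta> \<omega> = 0)"
      using \<delta>(1,2) by (rule integral_nonneg_eq_0_iff_AE)
    also have "\<dots> \<longleftrightarrow> (AE \<omega> in M. ?ham \<omega>)"
      using ham by (rule eventually_subst)
    finally show ?thesis .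
  qed
  then show ?thesis
    unfolding solves_iff_zero_gap by blast
qed

end

theorem theorem49:
  fixes M :: "'a measure" and T :: nat and F :: "nat \<Rightarrow> 'a measure"
    and K :: "nat \<Rightarrow> 'a \<Rightarrow> (real ^ 'd::finite) \<times> (real ^ 'd) \<Rightarrow> ereal"
    and S S' :: "('a \<Rightarrow> real ^ 'd) set"
    and x p y :: "nat \<Rightarrow> 'a \<Rightarrow> real ^ 'd"
  assumes "prob_space M"
    and "finite_filtration M T F"
    and "\<And>t. t \<le> T \<Longrightarrow> convex_normal_integrand M (K t)"
    and "rv_linear_space M S" and "decomposable M S" and "solid M S"
    and "rv_linear_space M S'" and "decomposable M S'" and "solid M S'"
    and "separating_duality M S S'"
    and "\<exists>x\<in>processes_in T S. \<exists>u\<in>processes_in T S. Ef M T K x u < \<infinity>"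
    and "\<exists>x. primal_feasible M T F K x"
    and "\<exists>py. dual_feasible M T F S S' K py"
  shows "primal_solves M T F K x \<and> dual_solves M T F S S' K (p, y) \<and>
           primal_value M T F K = dual_value M T F S S' K
     \<longleftrightarrow>
         primal_feasible M T F K x \<and> dual_feasible M T F S S' K (p, y) \<and>
           (AE \<omega> in M. \<forall>t\<le>T.
              p t \<omega> + fdiff T y t \<omega>
                \<in> subdifferential (\<lambda>x'. hamiltonian (K t \<omega>) x' (y t \<omega>)) (x t \<omega>) \<and>
              bdiff x t \<omega>
                \<in> subdifferential (\<lambda>y'. - hamiltonian (K t \<omega>) (x t \<omega>) y') (y t \<omega>))"
proof -
  interpret lagrange_problem M T F S S' K
    using assms(2-5,7,10) by unfold_locales
  show ?thesis
    by (rule optimality_conditions)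
qed

end
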